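(* Let $X$ be a set of reals. Then $B(X)$ satisfies $S_{fin}(\mathcal{D},\mathcal{D})$ if and only if $X$ satisfies $S_{fin}(B_\Omega, B_\Omega)$.
   Context: $B(X)$ is the set of all real-valued Borel functions on $X$ with the topology of pointwise convergence. $S_{fin}(\mathcal{A},\mathcal{B})$ means: for every sequence $(A_n:n\in\mathbb{N})$ of elements of $\mathcal{A}$ there are finite sets $B_n\subseteq A_n$ with $\bigcup_n B_n\in\mathcal{B}$. For the space $B(X)$, $\mathcal{D}$ is the family of all countable dense subsets of $B(X)$. A cover $\mathcal{U}$ of $X$ is an $\omega$-cover if $X\notin\mathcal{U}$ and every finite subset of $X$ is contained in some member of $\mathcal{U}$; $B_\Omega$ is the family of all countable $\omega$-covers of $X$ consisting of Borel sets. *)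

theory Defs
  imports "HOL-Analysis.Analysis"
begin

definition S_fin :: "'a set set \<Rightarrow> 'a set set \<Rightarrow> bool" where
  "S_fin \<A> \<B> \<longleftrightarrow>
     (\<forall>A :: nat \<Rightarrow> 'a set. (\<forall>n. A n \<in> \<A>) \<longrightarrow>
        (\<exists>B :: nat \<Rightarrow> 'a set. (\<forall>n. finite (B n) \<and> B n \<subseteq> A n) \<and> (\<Union>n. B n) \<in> \<B>))"

text \<open>B(X): real-valued Borel functions on X (X carries the subspace Borel
  structure), represented as extensional functions on X (points of the product
  space R^X).\<close>
definition Borel_funs :: "real set \<Rightarrow> (real \<Rightarrow> real) set" where
  "Borel_funs X = {f \<in> PiE X (\<lambda>_. UNIV). f \<in> borel_measurable (restrict_space borel X)}"

definition Borel_funs_top :: "real set \<Rightarrow> (real \<Rightarrow> real) topology" where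
  "Borel_funs_top X = subtopology (product_topology (\<lambda>_. euclideanreal) X) (Borel_funs X)"

definition countable_dense_Borel :: "real set \<Rightarrow> (real \<Rightarrow> real) set set" where
  "countable_dense_Borel X =
     {D. countable D \<and> D \<subseteq> Borel_funs X \<and> Borel_funs_top X closure_of D = Borel_funs X}"

definition omega_cover :: "'a set \<Rightarrow> 'a set set \<Rightarrow> bool" where
  "omega_cover X U \<longleftrightarrow> (\<forall>u\<in>U. u \<subseteq> X) \<and> X \<subseteq> \<Union>U \<and> X \<notin> U \<and>
     (\<forall>F. finite F \<and> F \<subseteq> X \<longrightarrow> (\<exists>u\<in>U. F \<subseteq> u))"

definition Borel_omega_covers :: "real set \<Rightarrow> real set set set" where
  "Borel_omega_covers X =
     {U. countable U \<and> omega_cover X U \<and> U \<subseteq> sets (restrict_space borel X)}"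

end

theory Submission
  imports Defs
begin

text \<open>
  From a selection principle for dense sets to one for covers: if \<open>Q\<close> is a countable dense set
  (one exists, namely rational step functions), then the functions equal to \<open>d \<in> Q\<close> on
  \<open>u \<in> \<U>\<close> and to \<open>1\<close> off \<open>u\<close> form a countable dense set for each \<open>\<omega>\<close>-cover \<open>\<U>\<close>; any function
  in it that is close to \<open>0\<close> on a finite set \<open>F\<close> has \<open>F \<subseteq> u\<close>.

  Conversely, the sets where \<open>g \<in> D\<^sub>n\<close> is \<open>1/(n+1)\<close>-close to \<open>f\<close> form an \<open>\<omega>\<close>-cover (unless some \<open>g\<close>
  is uniformly close to \<open>f\<close>), so finite selections from the \<open>D\<^sub>n\<close> can be made to accumulate at \<open>f\<close>.
  Doing this along infinitely many disjoint subsequences reaches every point of \<open>D\<^sub>0\<close>.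
\<close>

section \<open>Closure and density as approximation on finite sets\<close>

text \<open>A basic open set of the product constrains only finitely many coordinates, and the least
  of finitely many radii serves as a common tolerance.\<close>

lemma in_closure_of_Borel_funs_top:
  assumes "A \<subseteq> Borel_funs X"
  shows "f \<in> Borel_funs_top X closure_of A \<longleftrightarrow>
    f \<in> Borel_funs X \<and>
    (\<forall>F e. finite F \<longrightarrow> F \<subseteq> X \<longrightarrow> e > 0 \<longrightarrow> (\<exists>g\<in>A. \<forall>x\<in>F. \<bar>g x - f x\<bar> < e))"
    (is "?L \<longleftrightarrow> _ \<and> ?R")
proof -
  let ?P = "product_topology (\<lambda>_. euclideanreal) X"
  have L: "?L \<longleftrightarrow> f \<in> Borel_funs X \<and> f \<in> ?P closure_of A"
    using assms by (simp add: Borel_funs_top_def closure_of_subtopology Int_absorb1)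
  have "f \<in> ?P closure_of A \<longleftrightarrow> ?R" if f: "f \<in> Borel_funs X"
  proof
    assume cl: "f \<in> ?P closure_of A"
    show ?R
    proof (intro allI impI)
      fix F and e :: real
      assume F: "finite F" "F \<subseteq> X" "e > 0"
      \<comment> \<open>The open box that restricts only the coordinates in
        \<open>F\<close>.\<close>
      define T where "T = PiE X (\<lambda>x. if x \<in> F then ball (f x) e else UNIV)"
      have "openin ?P T"
        unfolding T_def
        by (rule product_topology_basis) (auto intro: finite_subset[OF _ F(1)])
      moreover have "f \<in> T"
        using f F by (auto simp: T_def Borel_funs_def PiE_iff)
      ultimately obtain g where "g \<in> A" "g \<in> T"
        using cl by (auto simp: in_closure_of)
      moreover have "\<bar>g x - f x\<bar> < e" if "x \<in> F" for x
      proof -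
        have "g x \<in> ball (f x) e"
          using PiE_mem[OF \<open>g \<in> T\<close>[unfolded T_def], of x] that F by auto
        then show ?thesis by (simp add: dist_real_def abs_minus_commute)
      qed
      ultimately show "\<exists>g\<in>A. \<forall>x\<in>F. \<bar>g x - f x\<bar> < e" by blast
    qed
  next
    assume R: ?R
    have "\<exists>g\<in>A. g \<in> T" if T: "f \<in> T" "openin ?P T" for T
    proof -
      obtain U where U: "finite {x \<in> X. U x \<noteq> UNIV}" "\<And>x. x \<in> X \<Longrightarrow> open (U x)"
          "f \<in> PiE X U" "PiE X U \<subseteq> T"
        using T by (auto simp: openin_product_topology_alt)
      define F where "F = {x \<in> X. U x \<noteq> UNIV}"
      have "\<exists>e>0. ball (f x) e \<subseteq> U x" if "x \<in> X" for x
        using U(2)[OF that] PiE_mem[OF U(3) that] open_contains_ball by blast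
      then obtain d where d: "\<And>x. x \<in> X \<Longrightarrow> d x > 0 \<and> ball (f x) (d x) \<subseteq> U x"
        by metis
      \<comment> \<open>The inserted \<open>1\<close> keeps the minimum defined when
        \<open>F\<close> is empty.\<close>
      define e where "e = Min (insert 1 (d ` F))"
      have finF: "finite F" "F \<subseteq> X" using U(1) by (auto simp: F_def)
      then have "e > 0" using d by (auto simp: e_def)
      then obtain g where g: "g \<in> A" "\<And>x. x \<in> F \<Longrightarrow> \<bar>g x - f x\<bar> < e"
        using R[rule_format, OF finF \<open>e > 0\<close>] by blast
      have "g x \<in> U x" if "x \<in> X" for x
      proof (cases "x \<in> F")
        case True
        then have "e \<le> d x" using finF by (auto simp: e_def)
        then have "g x \<in> ball (f x) (d x)"
          using g(2)[OF True] by (simp add: dist_real_def abs_minus_commute)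
        then show ?thesis using d that by blast
      qed (use that in \<open>auto simp: F_def\<close>)
      moreover have "g \<in> extensional X"
        using g(1) assms by (auto simp: Borel_funs_def PiE_iff)
      ultimately have "g \<in> PiE X U" by (simp add: PiE_iff)
      then show ?thesis using U(4) g(1) by blast
    qed
    then show "f \<in> ?P closure_of A"
      using f by (auto simp: in_closure_of Borel_funs_def)
  qed
  then show ?thesis using L by blast
qed

lemma restrict_in_Borel_funs:
  assumes "g \<in> borel_measurable (restrict_space borel X)"
  shows "restrict g X \<in> Borel_funs X"
proof -
  have "restrict g X \<in> borel_measurable (restrict_space borel X) \<longleftrightarrow>
      g \<in> borel_measurable (restrict_space borel X)"
    by (rule measurable_cong) (simp add: space_restrict_space)
  then show ?thesis using assms by (simp add: Borel_funs_def)
qed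

text \<open>The closure is taken inside \<open>Borel_funs X\<close>, so density amounts to every
  Borel function lying in it. From here on this replaces all topological arguments.\<close>

lemma countable_dense_Borel_iff:
  "D \<in> countable_dense_Borel X \<longleftrightarrow>
    countable D \<and> D \<subseteq> Borel_funs X \<and>
    (\<forall>f\<in>Borel_funs X. \<forall>F e. finite F \<longrightarrow> F \<subseteq> X \<longrightarrow> e > 0 \<longrightarrow> (\<exists>g\<in>D. \<forall>x\<in>F. \<bar>g x - f x\<bar> < e))"
proof (cases "D \<subseteq> Borel_funs X")
  case True
  have "Borel_funs_top X closure_of D \<subseteq> Borel_funs X"
    by (simp add: in_closure_of_Borel_funs_top[OF True] subset_iff)
  then have "Borel_funs_top X closure_of D = Borel_funs X \<longleftrightarrow>
      (\<forall>f\<in>Borel_funs X. f \<in> Borel_funs_top X closure_of D)"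
    by blast
  then show ?thesis
    using True by (simp add: countable_dense_Borel_def in_closure_of_Borel_funs_top[OF True])
qed (simp add: countable_dense_Borel_def)

lemma countable_dense_Borel_approx:
  assumes "D \<in> countable_dense_Borel X" "f \<in> Borel_funs X" "finite F" "F \<subseteq> X" "e > 0"
  obtains g where "g \<in> D" "\<forall>x\<in>F. \<bar>g x - f x\<bar> < e"
proof -
  have "\<exists>g\<in>D. \<forall>x\<in>F. \<bar>g x - f x\<bar> < e"
    using assms(1)[unfolded countable_dense_Borel_iff, THEN conjunct2, THEN conjunct2,
        rule_format, OF assms(2-5)] .
  then show thesis using that by blast
qed

section \<open>A countable dense set of rational step functions\<close>

text \<open>Lists of rational triples make the family countable. An entry at the head overrides the
  rest, so a value can be corrected near one point by a single cons.\<close>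

fun rat_step_fun :: "(rat \<times> rat \<times> rat) list \<Rightarrow> real \<Rightarrow> real" where
  "rat_step_fun [] x = 0"
| "rat_step_fun ((a, b, c) # l) x =
    (if of_rat a < x \<and> x < of_rat b then of_rat c else rat_step_fun l x)"

lemma rat_step_fun_measurable [measurable]: "rat_step_fun l \<in> borel_measurable borel"
proof (induction l)
  case (Cons t l)
  obtain a b c where t: "t = (a, b, c)" by (cases t)
  have [measurable]: "rat_step_fun l \<in> borel_measurable borel" by fact
  show ?case unfolding t rat_step_fun.simps by measurable
qed simp

lemma rat_between: "x < y \<Longrightarrow> \<exists>q. x < real_of_rat q \<and> real_of_rat q < y"
  using of_rat_dense by blast

lemma rat_step_fun_approx:
  assumes "finite F" "e > 0"
  shows "\<exists>l. \<forall>x\<in>F. \<bar>rat_step_fun l x - f x\<bar> < e"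
  using assms(1)
proof (induction F)
  case (insert x F)
  then obtain l where l: "\<forall>y\<in>F. \<bar>rat_step_fun l y - f y\<bar> < e" by blast
  \<comment> \<open>Being finite, \<open>F\<close> is closed, so a rational interval around
    \<open>x\<close> can miss it; prepending that interval leaves the values on \<open>F\<close>
    unchanged.\<close>
  have "open (- F)" using insert by (simp add: finite_imp_closed open_Compl)
  then obtain d where d: "d > 0" "ball x d \<subseteq> - F"
    using insert open_contains_ball by blast
  obtain a where a: "x - d < of_rat a" "of_rat a < x" using rat_between[of "x - d" x] d by auto
  obtain b where b: "x < of_rat b" "of_rat b < x + d" using rat_between[of x "x + d"] d by auto
  obtain c where c: "f x - e < of_rat c" "of_rat c < f x + e"
    using rat_between[of "f x - e" "f x + e"] assms by auto
  have "\<not> (of_rat a < y \<and> y < of_rat b)" if "y \<in> F" for y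
  proof
    assume "of_rat a < y \<and> y < of_rat b"
    then have "y \<in> ball x d" using a b by (auto simp: dist_real_def)
    then show False using d that by blast
  qed
  then have "\<forall>y\<in>insert x F. \<bar>rat_step_fun ((a, b, c) # l) y - f y\<bar> < e"
    using a b c l by (auto simp: abs_less_iff)
  then show ?case by blast
qed simp

lemma ex_countable_dense_Borel: "\<exists>Q. Q \<in> countable_dense_Borel X"
proof
  show "range (\<lambda>l. restrict (rat_step_fun l) X) \<in> countable_dense_Borel X"
    unfolding countable_dense_Borel_iff
  proof (intro conjI ballI allI impI)
    show "range (\<lambda>l. restrict (rat_step_fun l) X) \<subseteq> Borel_funs X"
      by (auto intro!: restrict_in_Borel_funs measurable_restrict_space1)
  next
    fix f :: "real \<Rightarrow> real" and F and e :: real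
    assume F: "finite F" "F \<subseteq> X" "e > 0"
    obtain l where "\<forall>x\<in>F. \<bar>rat_step_fun l x - f x\<bar> < e"
      using rat_step_fun_approx[OF F(1,3)] by blast
    then have "\<forall>x\<in>F. \<bar>restrict (rat_step_fun l) X x - f x\<bar> < e"
      using F(2) by auto
    then show "\<exists>g\<in>range (\<lambda>l. restrict (rat_step_fun l) X). \<forall>x\<in>F. \<bar>g x - f x\<bar> < e"
      by blast
  qed simp
qed

section \<open>Basic facts on \<omega>-covers\<close>

text \<open>Singletons are finite sets, so the covering condition follows from the condition on
  finite subsets; the other two conditions merge into strict inclusion.\<close>

lemma omega_cover_iff:
  "omega_cover X U \<longleftrightarrow>
    (\<forall>u\<in>U. u \<subset> X) \<and> (\<forall>F. finite F \<longrightarrow> F \<subseteq> X \<longrightarrow> (\<exists>u\<in>U. F \<subseteq> u))"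
proof -
  have "X \<subseteq> \<Union>U" if H: "\<forall>F. finite F \<longrightarrow> F \<subseteq> X \<longrightarrow> (\<exists>u\<in>U. F \<subseteq> u)"
  proof
    fix x assume "x \<in> X"
    then show "x \<in> \<Union>U" using H[rule_format, of "{x}"] by auto
  qed
  then have "omega_cover X U \<longleftrightarrow>
      (\<forall>u\<in>U. u \<subseteq> X) \<and> X \<notin> U \<and> (\<forall>F. finite F \<longrightarrow> F \<subseteq> X \<longrightarrow> (\<exists>u\<in>U. F \<subseteq> u))"
    unfolding omega_cover_def by (simp add: imp_conjL) argo
  then show ?thesis by (auto simp: psubset_eq)
qed

lemma omega_cover_psubset: "omega_cover X U \<Longrightarrow> u \<in> U \<Longrightarrow> u \<subset> X"
  by (simp add: omega_cover_iff)

lemma omega_cover_finite_subset: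
  assumes "omega_cover X U" "finite F" "F \<subseteq> X"
  obtains u where "u \<in> U" "F \<subseteq> u"
  using assms by (meson omega_cover_iff)

text \<open>Enlarging \<open>F\<close> by a point outside each member of \<open>W\<close> forces the covering set to avoid \<open>W\<close>.\<close>

lemma omega_cover_avoid_finite:
  assumes "omega_cover X U" "finite W" "W \<subseteq> U" "finite F" "F \<subseteq> X"
  shows "\<exists>u\<in>U - W. F \<subseteq> u"
proof -
  have "\<forall>w\<in>W. \<exists>x. x \<in> X \<and> x \<notin> w"
    using omega_cover_psubset[OF assms(1)] assms(3) by blast
  then obtain p where p: "\<And>w. w \<in> W \<Longrightarrow> p w \<in> X \<and> p w \<notin> w" by metis
  have "finite (F \<union> p ` W)" "F \<union> p ` W \<subseteq> X" using assms p by auto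
  then obtain u where "u \<in> U" "F \<union> p ` W \<subseteq> u"
    using omega_cover_finite_subset[OF assms(1)] by metis
  then show ?thesis using p by blast
qed

section \<open>From dense sets to \<omega>-covers\<close>

lemma S_fin_omega_covers_if_S_fin_dense:
  assumes S: "S_fin (countable_dense_Borel X) (countable_dense_Borel X)"
  shows "S_fin (Borel_omega_covers X) (Borel_omega_covers X)"
  unfolding S_fin_def
proof (intro allI impI)
  fix U :: "nat \<Rightarrow> real set set"
  assume U: "\<forall>n. U n \<in> Borel_omega_covers X"
  obtain Q where Q: "Q \<in> countable_dense_Borel X" using ex_countable_dense_Borel by blast
  define h where "h = (\<lambda>(d::real \<Rightarrow> real) u. restrict (\<lambda>x. if x \<in> u then d x else 1) X)"
  define D where "D n = (\<lambda>(d, u). h d u) ` (Q \<times> U n)" for n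
  have U_omega: "omega_cover X (U n)" and U_sets: "U n \<subseteq> sets (restrict_space borel X)"
    and U_count: "countable (U n)" for n
    using U by (auto simp: Borel_omega_covers_def)
  have h_Borel: "h d u \<in> Borel_funs X" if "d \<in> Q" "u \<in> U n" for d u n
  proof -
    have [measurable]: "d \<in> borel_measurable (restrict_space borel X)"
      using Q that by (auto simp: countable_dense_Borel_def Borel_funs_def)
    have [measurable]: "u \<in> sets (restrict_space borel X)" using U_sets that by blast
    have "(\<lambda>x. if x \<in> u then d x else 1) \<in> borel_measurable (restrict_space borel X)"
      by measurable
    then show ?thesis unfolding h_def by (rule restrict_in_Borel_funs)
  qed
  have "D n \<in> countable_dense_Borel X" for n
    unfolding countable_dense_Borel_iff
  proof (intro conjI ballI allI impI)
    show "countable (D n)"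
      using Q U_count by (auto simp: D_def countable_dense_Borel_def)
    show "D n \<subseteq> Borel_funs X" using h_Borel by (auto simp: D_def)
    fix f F and e :: real
    assume F: "f \<in> Borel_funs X" "finite F" "F \<subseteq> X" "e > 0"
    obtain d where d: "d \<in> Q" "\<forall>x\<in>F. \<bar>d x - f x\<bar> < e"
      using countable_dense_Borel_approx[OF Q F] by blast
    \<comment> \<open>Once \<open>F\<close> lies in \<open>u\<close>, \<open>h d u\<close> agrees
      with \<open>d\<close> on \<open>F\<close> and inherits its approximation.\<close>
    obtain u where u: "u \<in> U n" "F \<subseteq> u"
      using omega_cover_finite_subset[OF U_omega F(2,3)] by metis
    have "\<forall>x\<in>F. \<bar>h d u x - f x\<bar> < e" using d u F by (auto simp: h_def subset_iff)
    then show "\<exists>g\<in>D n. \<forall>x\<in>F. \<bar>g x - f x\<bar> < e"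
      using d u by (force simp: D_def)
  qed
  then obtain E where E: "\<And>n. finite (E n) \<and> E n \<subseteq> D n"
      "(\<Union>n. E n) \<in> countable_dense_Borel X"
    using S unfolding S_fin_def by metis
  \<comment> \<open>A function in \<open>E n\<close> may arise from several pairs; fixing finitely
    many pairs that produce \<open>E n\<close> yields a finite choice of members of
    \<open>U n\<close>.\<close>
  have "\<exists>C \<subseteq> Q \<times> U n. finite C \<and> E n = (\<lambda>(d, u). h d u) ` C" for n
    using E(1)[of n] unfolding D_def by (meson finite_subset_image)
  then obtain C where C: "\<And>n. C n \<subseteq> Q \<times> U n" "\<And>n. finite (C n)"
      "\<And>n. E n = (\<lambda>(d, u). h d u) ` C n"
    by metis
  have sub: "snd ` C n \<subseteq> U n" for n using C(1)[of n] by auto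
  have zero: "restrict (\<lambda>_. 0) X \<in> Borel_funs X"
    by (rule restrict_in_Borel_funs) simp
  have "\<exists>u\<in>\<Union>n. snd ` C n. F \<subseteq> u" if F: "finite F" "F \<subseteq> X" for F
  proof -
    \<comment> \<open>Tolerance \<open>1\<close> around the zero function excludes the value
      \<open>1\<close>, which \<open>h d u\<close> takes at every point of \<open>X\<close> off
      \<open>u\<close>.\<close>
    obtain g where g: "g \<in> (\<Union>n. E n)" "\<forall>x\<in>F. \<bar>g x - restrict (\<lambda>_. 0) X x\<bar> < 1"
      using countable_dense_Borel_approx[OF E(2) zero F zero_less_one] by blast
    then obtain n d u where du: "(d, u) \<in> C n" "g = h d u" using C(3) by auto
    have "F \<subseteq> u" using g(2) du(2) F by (fastforce simp: h_def subset_iff split: if_splits)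
    then show ?thesis using du(1) by force
  qed
  moreover have "\<forall>u\<in>\<Union>n. snd ` C n. u \<subset> X"
    using sub omega_cover_psubset[OF U_omega] by blast
  ultimately have "omega_cover X (\<Union>n. snd ` C n)"
    by (simp add: omega_cover_iff)
  moreover have "countable (\<Union>n. snd ` C n)"
    using C(2) by (auto intro: countable_finite)
  moreover have "(\<Union>n. snd ` C n) \<subseteq> sets (restrict_space borel X)"
    using sub U_sets by blast
  ultimately have "(\<Union>n. snd ` C n) \<in> Borel_omega_covers X"
    unfolding Borel_omega_covers_def by blast
  then show "\<exists>B. (\<forall>n. finite (B n) \<and> B n \<subseteq> U n) \<and> (\<Union>n. B n) \<in> Borel_omega_covers X"
    using C(2) sub by (intro exI[of _ "\<lambda>n. snd ` C n"]) auto
qed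

section \<open>From \<omega>-covers to dense sets\<close>

text \<open>This treats a single target \<open>f\<close>. The tolerance shrinks with the index, so a
  good approximation is obtained by forcing the covering set to come from a late selection.\<close>

lemma finite_selection_accumulating:
  assumes S: "S_fin (Borel_omega_covers X) (Borel_omega_covers X)"
    and D: "\<And>n::nat. D n \<in> countable_dense_Borel X" and f: "f \<in> Borel_funs X"
  shows "\<exists>E. (\<forall>n. finite (E n) \<and> E n \<subseteq> D n) \<and>
    (\<forall>F e. finite F \<longrightarrow> F \<subseteq> X \<longrightarrow> e > 0 \<longrightarrow> (\<exists>g\<in>\<Union>n. E n. \<forall>x\<in>F. \<bar>g x - f x\<bar> < e))"
proof -
  define V where "V n g = {x \<in> X. \<bar>g x - f x\<bar> < 1 / Suc n}" for n and g :: "real \<Rightarrow> real"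
  have small: "\<exists>N. \<forall>n\<ge>N. 1 / Suc n < e" if "e > 0" for e :: real
  proof -
    obtain N where N: "1 / Suc N < e"
      using \<open>e > 0\<close> nat_approx_posE by blast
    have "1 / Suc n < e" if "n \<ge> N" for n
      using N that frac_le[of 1 1 "Suc N" "Suc n"] by auto
    then show ?thesis by blast
  qed
  show ?thesis
  proof (cases "\<exists>N. \<forall>n\<ge>N. \<forall>g\<in>D n. V n g \<noteq> X")
    \<comment> \<open>For infinitely many \<open>n\<close> some \<open>g\<close> in
      \<open>D n\<close> is within \<open>1 / Suc n\<close> of \<open>f\<close> on all of
      \<open>X\<close>. One such function per available index suffices, with the empty selection
      elsewhere.\<close>
    case False
    define E where "E n = (if \<exists>g\<in>D n. V n g = X then {SOME g. g \<in> D n \<and> V n g = X} else {})" for n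
    have E: "finite (E n) \<and> E n \<subseteq> D n" "g \<in> E n \<Longrightarrow> V n g = X" for n g
      using someI_ex[of "\<lambda>g. g \<in> D n \<and> V n g = X"]
      by (auto simp: E_def split: if_splits)
    have "\<exists>g\<in>\<Union>n. E n. \<forall>x\<in>F. \<bar>g x - f x\<bar> < e" if F: "F \<subseteq> X" "e > 0" for F e
    proof -
      obtain N where N: "\<forall>n\<ge>N. 1 / Suc n < e" using small F by blast
      obtain n where n: "n \<ge> N" "\<exists>g\<in>D n. V n g = X" using False by blast
      then obtain g where g: "g \<in> E n" by (auto simp: E_def)
      have "\<bar>g x - f x\<bar> < e" if "x \<in> F" for x
      proof -
        have "x \<in> V n g" using E(2)[OF g] that F by blast
        then have "\<bar>g x - f x\<bar> < 1 / Suc n" by (simp add: V_def)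
        also have "\<dots> < e" using N n(1) by blast
        finally show ?thesis .
      qed
      then show ?thesis using g by blast
    qed
    then show ?thesis using E(1) by (intro exI[of _ E]) blast
  next
    case True
    \<comment> \<open>From \<open>N\<close> on every \<open>V n g\<close> is a proper subset of
      \<open>X\<close>, as an \<omega>-cover demands; hence the shift of indices by
      \<open>N\<close>.\<close>
    then obtain N where N: "\<And>n g. n \<ge> N \<Longrightarrow> g \<in> D n \<Longrightarrow> V n g \<noteq> X" by blast
    define U where "U n = V (n + N) ` D (n + N)" for n
    have "U n \<in> Borel_omega_covers X" for n
    proof -
      have "V m g \<in> sets (restrict_space borel X)" if "g \<in> D m" for m g
      proof -
        have [measurable]: "g \<in> borel_measurable (restrict_space borel X)"
            "f \<in> borel_measurable (restrict_space borel X)"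
          using D[of m] that f by (auto simp: countable_dense_Borel_def Borel_funs_def)
        have "{x \<in> space (restrict_space borel X). \<bar>g x - f x\<bar> < 1 / Suc m}
            \<in> sets (restrict_space borel X)"
          by measurable
        then show ?thesis by (simp add: V_def space_restrict_space)
      qed
      moreover have "omega_cover X (U n)"
        unfolding omega_cover_iff
      proof (intro conjI allI impI)
        show "\<forall>u\<in>U n. u \<subset> X"
          using N[of "n + N"] by (auto simp: U_def V_def psubset_eq)
        fix F assume F: "finite F" "F \<subseteq> X"
        have "1 / real (Suc (n + N)) > 0" by simp
        then obtain g where "g \<in> D (n + N)" "\<forall>x\<in>F. \<bar>g x - f x\<bar> < 1 / Suc (n + N)"
          using countable_dense_Borel_approx[OF D f F] by blast
        then show "\<exists>u\<in>U n. F \<subseteq> u" using F by (auto simp: U_def V_def)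
      qed
      moreover have "countable (U n)"
        using D by (auto simp: U_def countable_dense_Borel_def)
      ultimately show ?thesis by (auto simp: Borel_omega_covers_def U_def)
    qed
    then obtain W where W: "\<And>n. finite (W n) \<and> W n \<subseteq> U n"
        "(\<Union>n. W n) \<in> Borel_omega_covers X"
      using S unfolding S_fin_def by metis
    have "\<exists>C \<subseteq> D (n + N). finite C \<and> W n = V (n + N) ` C" for n
      using W(1)[of n] unfolding U_def by (meson finite_subset_image)
    then obtain C where C: "\<And>n. C n \<subseteq> D (n + N)" "\<And>n. finite (C n)"
        "\<And>n. W n = V (n + N) ` C n"
      by metis
    \<comment> \<open>Undoes the shift: nothing is selected before index \<open>N\<close>.\<close>
    define E where "E m = (if m < N then {} else C (m - N))" for m
    have E: "finite (E n) \<and> E n \<subseteq> D n" for n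
      using C(1)[of "n - N"] C(2) by (auto simp: E_def)
    have "\<exists>g\<in>\<Union>n. E n. \<forall>x\<in>F. \<bar>g x - f x\<bar> < e" if F: "finite F" "F \<subseteq> X" "e > 0" for F e
    proof -
      obtain M where M: "\<forall>n\<ge>M. 1 / Suc n < e" using small F by blast
      have "omega_cover X (\<Union>n. W n)" using W(2) by (simp add: Borel_omega_covers_def)
      \<comment> \<open>The first \<open>M\<close> selections are finite in total and can be
        avoided, so \<open>u\<close> comes from some \<open>W n\<close> with
        \<open>n \<ge> M\<close>, where the tolerance is below \<open>e\<close>.\<close>
      then obtain u where u: "u \<in> (\<Union>n. W n) - (\<Union>n<M. W n)" "F \<subseteq> u"
        using omega_cover_avoid_finite[of X "\<Union>n. W n" "\<Union>n<M. W n" F] W(1) F by blast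
      then obtain n where n: "u \<in> W n" by blast
      have "n \<ge> M" using u(1) n by (metis DiffD2 UN_I lessThan_iff not_less)
      obtain g where g: "g \<in> C n" "u = V (n + N) g" using n C(3) by blast
      have "1 / Suc (n + N) < e" using M \<open>n \<ge> M\<close> trans_le_add1 by blast
      moreover have "\<bar>g x - f x\<bar> < 1 / Suc (n + N)" if "x \<in> F" for x
        using u(2) that unfolding g(2) V_def by blast
      ultimately have "\<forall>x\<in>F. \<bar>g x - f x\<bar> < e" by (meson less_trans)
      moreover have "g \<in> E (n + N)" using g(1) by (simp add: E_def)
      ultimately show ?thesis by blast
    qed
    then show ?thesis using E by (intro exI[of _ E]) blast
  qed
qed

lemma S_fin_dense_if_S_fin_omega_covers:
  assumes S: "S_fin (Borel_omega_covers X) (Borel_omega_covers X)"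
  shows "S_fin (countable_dense_Borel X) (countable_dense_Borel X)"
  unfolding S_fin_def
proof (intro allI impI)
  fix D :: "nat \<Rightarrow> (real \<Rightarrow> real) set"
  assume "\<forall>n. D n \<in> countable_dense_Borel X"
  then have D: "D n \<in> countable_dense_Borel X" for n by blast
  have D0: "countable (D 0)" "D 0 \<subseteq> Borel_funs X"
    using D[of 0] by (auto simp: countable_dense_Borel_def)
  have "restrict (\<lambda>_. 0) X \<in> Borel_funs X"
    by (rule restrict_in_Borel_funs) simp
  \<comment> \<open>Approximating the zero function on the empty set already produces an element.
    Nonemptiness lets \<open>from_nat_into\<close> enumerate exactly \<open>D 0\<close>, possibly
    with repetitions.\<close>
  then have "D 0 \<noteq> {}"
    using countable_dense_Borel_approx[OF D _ finite.emptyI empty_subsetI zero_less_one] by blast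
  define d where "d = from_nat_into (D 0)"
  have d: "range d = D 0" unfolding d_def
    using D0 \<open>D 0 \<noteq> {}\<close> by (simp add: range_from_nat_into)
  \<comment> \<open>The pairing function splits the indices into disjoint rows; row \<open>k\<close>
    is devoted to the target \<open>d k\<close>.\<close>
  have "\<exists>E. (\<forall>n. finite (E n) \<and> E n \<subseteq> D (prod_encode (k, n))) \<and>
    (\<forall>F e. finite F \<longrightarrow> F \<subseteq> X \<longrightarrow> e > 0 \<longrightarrow> (\<exists>g\<in>\<Union>n. E n. \<forall>x\<in>F. \<bar>g x - d k x\<bar> < e))" for k
    using d D0 by (intro finite_selection_accumulating S D) auto
  then obtain E where E: "\<And>k n. finite (E k n) \<and> E k n \<subseteq> D (prod_encode (k, n))"
    "\<And>k F e. finite F \<Longrightarrow> F \<subseteq> X \<Longrightarrow> e > 0 \<Longrightarrow> \<exists>g\<in>\<Union>n. E k n. \<forall>x\<in>F. \<bar>g x - d k x\<bar> < e"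
    by metis
  \<comment> \<open>Each index \<open>m\<close> belongs to exactly one row, so it receives just one
    finite selection.\<close>
  define B where "B m = case_prod E (prod_decode m)" for m
  have B: "finite (B m) \<and> B m \<subseteq> D m" for m
    using E(1)[of "fst (prod_decode m)" "snd (prod_decode m)"]
    by (simp add: B_def case_prod_beta)
  have EB: "E k n \<subseteq> (\<Union>m. B m)" for k n
    using UN_upper[of "prod_encode (k, n)" UNIV B] by (simp add: B_def)
  have "(\<Union>m. B m) \<in> countable_dense_Borel X"
    unfolding countable_dense_Borel_iff
  proof (intro conjI ballI allI impI)
    show "countable (\<Union>m. B m)" using B by (auto intro: countable_finite)
    show "(\<Union>m. B m) \<subseteq> Borel_funs X" using B D unfolding countable_dense_Borel_def by blast
    fix f F and e :: real
    assume F: "f \<in> Borel_funs X" "finite F" "F \<subseteq> X" "e > 0"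
    \<comment> \<open>Half of the tolerance goes to approximating \<open>f\<close> by some
      \<open>d k\<close> in \<open>D 0\<close>, half to approximating \<open>d k\<close> by a
      selected function.\<close>
    then have "e / 2 > 0" by simp
    then obtain g where "g \<in> D 0" and g: "\<forall>x\<in>F. \<bar>g x - f x\<bar> < e / 2"
      using countable_dense_Borel_approx[OF D F(1-3)] by blast
    then obtain k where k: "g = d k" using d by blast
    obtain g' where g': "g' \<in> (\<Union>n. E k n)" "\<forall>x\<in>F. \<bar>g' x - d k x\<bar> < e / 2"
      using E(2)[OF F(2,3) \<open>e / 2 > 0\<close>] by blast
    have "\<bar>g' x - f x\<bar> < e" if "x \<in> F" for x
      using bspec[OF g that] bspec[OF g'(2) that] unfolding k by linarith
    moreover have "g' \<in> (\<Union>m. B m)" using g'(1) EB by blast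
    ultimately show "\<exists>g\<in>\<Union>m. B m. \<forall>x\<in>F. \<bar>g x - f x\<bar> < e" by blast
  qed
  then show "\<exists>B. (\<forall>n. finite (B n) \<and> B n \<subseteq> D n) \<and> (\<Union>n. B n) \<in> countable_dense_Borel X"
    using B by blast
qed

theorem theorem3p5:
  fixes X :: "real set"
  shows "S_fin (countable_dense_Borel X) (countable_dense_Borel X)
     \<longleftrightarrow> S_fin (Borel_omega_covers X) (Borel_omega_covers X)"
  using S_fin_omega_covers_if_S_fin_dense S_fin_dense_if_S_fin_omega_covers by blast

end
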